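(* Let $f:\mathbb{R}^n\to\mathbb{R}$ be a continuous function, let $\mathcal{X}\subset\mathbb{Z}^n$ be bounded, and let $h_1,\dots,h_m\in\mathbb{Z}[x]=\mathbb{Z}[x_1,\dots,x_n]$ be polynomials with integer coefficients such that $h_j(x)\ge 0$ for every $x\in\mathcal{X}$ and $j=1,\dots,m$. Let $\mathcal{H}=\{x\in\mathbb{R}^n: h_j(x)=0,\ j=1,\dots,m\}$ and assume $\mathcal{X}\cap\mathcal{H}\neq\emptyset$. Then for any $y\in\mathbb{R}^m$ such that $$y_j\ge \min\{f(x):x\in\mathcal{X},\ x\in\mathcal{H}\}-\min\{f(x):x\in\mathcal{X}\},\qquad j=1,\dots,m,$$ the problem $(D_y)$: $\min_{x\in\mathcal{X}}\big(f(x)+\sum_{j=1}^m y_jh_j(x)\big)$ is a Lagrangian reformulation of the problem $(P)$: $\min\{f(x): h_j(x)=0,\ j=1,\dots,m,\ x\in\mathcal{X}\}$.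
   Context: $(D_y)$ is a Lagrangian reformulation of $(P)$ if the optimal values of $(P)$ and $(D_y)$ coincide. *)

theory Defs
  imports "HOL-Analysis.Analysis" "HOL-Library.Poly_Mapping"
begin

text \<open>Polynomials in \<open>\<int>[x\<^sub>1, \<dots>, x\<^sub>n]\<close>: finitely supported maps from exponent vectors
  to coefficients, with the variables indexed by the coordinates of \<open>real ^ 'n\<close>.\<close>

type_synonym 'n int_mpoly = "('n \<Rightarrow>\<^sub>0 nat) \<Rightarrow>\<^sub>0 int"

definition eval_mpoly :: "'n::finite int_mpoly \<Rightarrow> real ^ 'n \<Rightarrow> real" where
  "eval_mpoly p x =
     (\<Sum>a\<in>Poly_Mapping.keys p.
        of_int (Poly_Mapping.lookup p a) * (\<Prod>i\<in>UNIV. (x $ i) ^ Poly_Mapping.lookup a i))"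

definition integer_points :: "(real ^ 'n) set" where
  "integer_points = {x. \<forall>i. x $ i \<in> \<int>}"

definition common_zeros :: "('m \<Rightarrow> 'a \<Rightarrow> real) \<Rightarrow> 'a set" where
  "common_zeros h = {x. \<forall>j. h j x = 0}"

text \<open>The optimal value is extended real, so that infeasible problems have value \<open>\<infinity>\<close> and
  unbounded ones \<open>-\<infinity>\<close>.\<close>

definition optimal_value :: "('a \<Rightarrow> real) \<Rightarrow> 'a set \<Rightarrow> ereal" where
  "optimal_value f S = (INF x\<in>S. ereal (f x))"

definition lagrangian ::
  "('a \<Rightarrow> real) \<Rightarrow> ('m::finite \<Rightarrow> 'a \<Rightarrow> real) \<Rightarrow> real ^ 'm \<Rightarrow> 'a \<Rightarrow> real" where
  "lagrangian f h y x = f x + (\<Sum>j\<in>UNIV. y $ j * h j x)"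

text \<open>The problem \<open>(D\<^sub>y)\<close>, minimising \<open>lagrangian f h y\<close> over \<open>X\<close>, has the same optimal value as
  \<open>(P)\<close>, minimising \<open>f\<close> over the points of \<open>X\<close> at which all \<open>h j\<close> vanish.\<close>

definition lagrangian_reformulation ::
  "('a \<Rightarrow> real) \<Rightarrow> ('m::finite \<Rightarrow> 'a \<Rightarrow> real) \<Rightarrow> 'a set \<Rightarrow> real ^ 'm \<Rightarrow> bool" where
  "lagrangian_reformulation f h X y \<longleftrightarrow>
     optimal_value (lagrangian f h y) X = optimal_value f (X \<inter> common_zeros h)"

end

theory Submission
  imports Defs
begin

text \<open>At the points of \<open>X\<close> in \<open>\<H>\<close> the penalty vanishes. At any other point of \<open>X\<close> some \<open>h\<^sub>j\<close> is a
  positive integer, hence at least 1, so the penalty is at least \<open>y\<^sub>j\<close>, which covers the gap between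
  the constrained and the unconstrained minimum of \<open>f\<close>. All minima are attained because a bounded
  set of integer points is finite.\<close>

text \<open>Each coordinate is bounded in absolute value by the norm, so it lies in a finite set of
  integers, and \<open>X\<close> embeds in a finite product of copies of that set.\<close>

lemma finite_bounded_integer_points:
  fixes X :: "(real ^ 'n) set"
  assumes "X \<subseteq> integer_points" "bounded X"
  shows "finite X"
proof -
  obtain B where B: "norm x \<le> B" if "x \<in> X" for x
    using assms(2) by (auto simp: bounded_iff)
  define S :: "real set" where "S = {k \<in> \<int>. \<bar>k\<bar> \<le> B}"
  have "finite S"
    unfolding S_def by (rule finite_abs_int_segment)
  have "x \<in> vec_lambda ` (\<Pi>\<^sub>E i\<in>UNIV. S)" if "x \<in> X" for x
  proof
    show "x = vec_lambda (vec_nth x)"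
      by simp
    have "x $ i \<in> S" for i
      using assms(1) that B[OF that] component_le_norm_cart[of x i]
      by (auto simp: S_def integer_points_def)
    then show "vec_nth x \<in> (\<Pi>\<^sub>E i\<in>UNIV. S)"
      by auto
  qed
  moreover have "finite (vec_lambda ` (\<Pi>\<^sub>E i\<in>(UNIV :: 'n set). S))"
    using \<open>finite S\<close> by (intro finite_imageI finite_PiE) auto
  ultimately show ?thesis
    by (meson finite_subset subsetI)
qed

lemma eval_mpoly_integer_points:
  assumes "x \<in> integer_points"
  shows "eval_mpoly p x \<in> \<int>"
  using assms unfolding eval_mpoly_def integer_points_def
  by (intro Ints_sum Ints_mult Ints_prod Ints_power) auto

text \<open>The argument rests on finiteness of \<open>X\<close> and integrality of the values
  \<open>h j x\<close>, so polynomials and integer vectors are abstracted away.\<close>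

lemma lagrangian_reformulation_exact_penalty:
  fixes h :: "'m::finite \<Rightarrow> 'a \<Rightarrow> real"
  assumes "finite X"
    and int: "\<And>j x. x \<in> X \<Longrightarrow> h j x \<in> \<int>"
    and nonneg: "\<And>j x. x \<in> X \<Longrightarrow> h j x \<ge> 0"
    and nonempty: "X \<inter> common_zeros h \<noteq> {}"
    and y: "\<And>j. y $ j \<ge> Min (f ` (X \<inter> common_zeros h)) - Min (f ` X)"
  shows "lagrangian_reformulation f h X y"
proof -
  let ?F = "X \<inter> common_zeros h"
  define c where "c = Min (f ` ?F)"
  have eq: "lagrangian f h y x = f x" if "x \<in> ?F" for x
    using that by (simp add: lagrangian_def common_zeros_def)
  have c_in: "c \<in> f ` ?F"
    unfolding c_def using assms(1) nonempty by (intro Min_in) auto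
  have c_le: "c \<le> f x" if "x \<in> ?F" for x
    unfolding c_def using assms(1) that by (intro Min_le) auto
  have m_le: "Min (f ` X) \<le> f x" if "x \<in> X" for x
    using assms(1) that by (intro Min_le) auto
  have y_nonneg: "y $ j \<ge> 0" for j
    using y[of j] c_in m_le by (fastforce simp flip: c_def)
  have bound: "c \<le> lagrangian f h y x" if "x \<in> X" for x
  proof (cases "x \<in> common_zeros h")
    case True
    then show ?thesis
      using eq c_le that by simp
  next
    case False
    then obtain j where "h j x \<noteq> 0"
      by (auto simp: common_zeros_def)
    then have "h j x \<ge> 1"
      using Ints_nonzero_abs_ge1[OF int[OF that, of j]] nonneg[OF that, of j] by simp
    then have "y $ j \<le> y $ j * h j x"
      using mult_left_mono[of 1 "h j x" "y $ j"] y_nonneg by simp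
    \<comment> \<open>One violated constraint suffices: all other summands are nonnegative.\<close>
    also have "\<dots> \<le> (\<Sum>j\<in>UNIV. y $ j * h j x)"
      using nonneg[OF that] y_nonneg by (intro member_le_sum) auto
    finally show ?thesis
      using y[of j] m_le[OF that] by (simp add: lagrangian_def c_def)
  qed
  show ?thesis
    unfolding lagrangian_reformulation_def optimal_value_def
  proof (rule antisym)
    \<comment> \<open>Weak duality: each feasible point lies in \<open>X\<close> and has the same
      value in both problems.\<close>
    show "(INF x\<in>X. ereal (lagrangian f h y x)) \<le> (INF x\<in>?F. ereal (f x))"
      by (rule INF_mono) (use eq in force)
    have "(INF x\<in>?F. ereal (f x)) \<le> ereal c"
      using c_in by (auto intro: INF_lower)
    also have "\<dots> \<le> (INF x\<in>X. ereal (lagrangian f h y x))"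
      using bound by (intro INF_greatest) simp
    finally show "(INF x\<in>?F. ereal (f x)) \<le> (INF x\<in>X. ereal (lagrangian f h y x))" .
  qed
qed

theorem corollary1:
  fixes f :: "real ^ 'n \<Rightarrow> real"
    and X :: "(real ^ 'n) set"
    and h :: "'m::finite \<Rightarrow> 'n int_mpoly"
    and H :: "(real ^ 'n) set"
    and y :: "real ^ 'm"
  assumes "continuous_on UNIV f"
    and "X \<subseteq> integer_points"
    and "bounded X"
    and "\<And>j x. x \<in> X \<Longrightarrow> eval_mpoly (h j) x \<ge> 0"
    and "H = common_zeros (\<lambda>j. eval_mpoly (h j))"
    and "X \<inter> H \<noteq> {}"
    and "\<And>j. y $ j \<ge> Min (f ` (X \<inter> H)) - Min (f ` X)"
  shows "lagrangian_reformulation f (\<lambda>j. eval_mpoly (h j)) X y"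
proof (rule lagrangian_reformulation_exact_penalty)
  show "finite X"
    using assms(2,3) by (rule finite_bounded_integer_points)
  show "eval_mpoly (h j) x \<in> \<int>" if "x \<in> X" for j x
    using assms(2) that by (auto intro: eval_mpoly_integer_points)
qed (use assms in auto)

end
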